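(* Let $H$ be a real Hilbert space with unit sphere $S_H=\{x\in H : \|x\|=1\}$ equipped with the metric $d(x,y)=\arccos\langle x,y\rangle$. Let $C$ be a closed convex subset of $S_H$ such that $d(v,v')<\pi/2$ for every $v,v'\in C$. Let $r\ge 1$ be an integer, let $0<a<1/2$, and let $\alpha_{n,1},\alpha_{n,2},\ldots,\alpha_{n,r}$ ($n\in\mathbb{N}$) be real numbers such that $\alpha_{n,i}\in[a,1-a]$ for every $n\in\mathbb{N}$ and every $i=1,2,\ldots,r$. Let $T_1,T_2,\ldots,T_r$ be nonexpansive mappings of $C$ into itself such that $F:=\bigcap_{i=1}^r F(T_i)\neq\emptyset$. For each $n\in\mathbb{N}$ let $W_n$ be the $W$-mapping of $C$ into itself generated by $T_1,T_2,\ldots,T_r$ and $\alpha_{n,1},\alpha_{n,2},\ldots,\alpha_{n,r}$. For a given point $x_1\in C$, put $C_0:=C$ and let $\{x_n\}$ be the sequence in $C$ generated by \begin{align*} y_n &:= W_nx_n,\\ C_n &:= \{z\in C : d(y_n,z)\leq d(x_n,z)\}\cap C_{n-1},\\ x_{n+1} &:= P_{C_n}x_1 \end{align*} for all $n\in\mathbb{N}$. Then $\{x_n\}$ is well defined and converges (in the metric $d$) to $P_Fx_1$.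
   Context: $\mathbb{N}=\{1,2,3,\ldots\}$. Geodesics and convexity: for $x,y\in S_H$ with $d(x,y)<\pi$ there is a unique geodesic segment $[x,y]$ in $S_H$ joining $x$ to $y$ (the shorter great-circle arc). A subset $C\subset S_H$ all of whose pairs of points are at distance less than $\pi/2$ is convex if $[x,y]\subset C$ for all $x,y\in C$. For $\alpha\in[0,1]$, $\alpha x\oplus(1-\alpha)y$ denotes the unique point $z\in[x,y]$ with $d(y,z)=\alpha d(x,y)$ and $d(x,z)=(1-\alpha)d(x,y)$. Mappings: $T:C\to C$ is nonexpansive if $d(Tx,Ty)\le d(x,y)$ for all $x,y\in C$; $F(T)=\{z\in C : Tz=z\}$ is its fixed point set; $I$ is the identity mapping. $W$-mapping: given mappings $T_1,\ldots,T_r$ of $C$ into itself and real numbers $\alpha_1,\ldots,\alpha_r\in[0,1]$, define inductively (pointwise) $U_1:=\alpha_1T_1\oplus(1-\alpha_1)I$, and $U_k:=\alpha_kT_kU_{k-1}\oplus(1-\alpha_k)I$ for $k=2,\ldots,r$. The mapping $W:=U_r$ is called the $W$-mapping generated by $T_1,\ldots,T_r$ and $\alpha_1,\ldots,\alpha_r$. Metric projection: for a nonempty closed convex subset $K$ of $C$ and $x\in C$, $P_Kx$ denotes the unique point of $K$ with $d(x,P_Kx)=\inf_{y\in K}d(x,y)$. (The fixed point set of a nonexpansive mapping of $C$ into itself is closed and convex, so $P_F$ makes sense.) "Well defined" means that at each step the set $C_n$ is a nonempty closed convex subset of $C$, so that the projection defining $x_{n+1}$ exists. *)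

theory Defs
  imports "HOL-Analysis.Analysis"
begin

text \<open>Throughout, the unit sphere of H is \<^term>\<open>sphere 0 1\<close>. The distance is only meaningful there;
  the value 0 elsewhere is a dummy, needed because \<^locale>\<open>Metric_space\<close> demands symmetry and
  nonnegativity on the whole type, whereas \<^const>\<open>arccos\<close> is unspecified outside [-1, 1].\<close>

definition sdist :: "'a::real_inner \<Rightarrow> 'a \<Rightarrow> real"
  where "sdist x y = (if x \<in> sphere 0 1 \<and> y \<in> sphere 0 1 then arccos (x \<bullet> y) else 0)"

lemma sdist_eq: "norm x = 1 \<Longrightarrow> norm y = 1 \<Longrightarrow> sdist x y = arccos (x \<bullet> y)"
  by (simp add: sdist_def)

lemma inner_bounds_sphere:
  fixes x y :: "'a::real_inner"
  assumes "norm x = 1" "norm y = 1"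
  shows "-1 \<le> x \<bullet> y" "x \<bullet> y \<le> 1"
  using Cauchy_Schwarz_ineq2[of x y] assms by auto

lemma cos_sdist:
  fixes x y :: "'a::real_inner"
  assumes "norm x = 1" "norm y = 1"
  shows "cos (sdist x y) = x \<bullet> y"
  using inner_bounds_sphere[OF assms] assms by (simp add: sdist_eq)

lemma sdist_bounds:
  fixes x y :: "'a::real_inner"
  assumes "norm x = 1" "norm y = 1"
  shows "0 \<le> sdist x y" "sdist x y \<le> pi"
  using inner_bounds_sphere[OF assms] assms by (auto simp: sdist_eq intro: arccos_lbound arccos_ubound)

lemma sphere_eqI:
  fixes x y :: "'a::real_inner"
  assumes "norm x = 1" "norm y = 1" "x \<bullet> y = 1"
  shows "x = y"
proof -
  have "(x - y) \<bullet> (x - y) = 0"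
    using assms by (simp add: inner_diff_left inner_diff_right inner_commute norm_eq_1)
  then show ?thesis by simp
qed

lemma sdist_triangle:
  fixes x y z :: "'a::real_inner"
  assumes n: "norm x = 1" "norm y = 1" "norm z = 1"
  shows "sdist x z \<le> sdist x y + sdist y z"
proof (cases "sdist x y + sdist y z \<le> pi")
  case False
  then show ?thesis using sdist_bounds(2)[OF n(1,3)] by simp
next
  case True
  define a b where ab: "a = sdist x y" "b = sdist y z"
  have c: "cos a = x \<bullet> y" "cos b = y \<bullet> z" using cos_sdist n ab by auto
  have r: "0 \<le> a" "0 \<le> b" "a \<le> pi" "b \<le> pi" using sdist_bounds n ab by auto
  have i: "x \<bullet> x = 1" "y \<bullet> y = 1" "z \<bullet> z = 1" using n by (auto simp: norm_eq_1)
  define u v where uv: "u = x - cos a *\<^sub>R y" "v = z - cos b *\<^sub>R y"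
  have "u \<bullet> u = 1 - (cos a)\<^sup>2" "v \<bullet> v = 1 - (cos b)\<^sup>2"
    unfolding uv using i c
    by (simp_all add: inner_diff_left inner_diff_right inner_commute power2_eq_square)
  then have "u \<bullet> u = (sin a)\<^sup>2" "v \<bullet> v = (sin b)\<^sup>2" by (simp_all add: sin_squared_eq)
  then have "norm u = sin a" "norm v = sin b"
    using r by (simp_all add: norm_eq_sqrt_inner sin_ge_zero)
  then have "- (sin a * sin b) \<le> u \<bullet> v" using Cauchy_Schwarz_ineq2[of u v] by simp
  also have "u \<bullet> v = x \<bullet> z - cos a * cos b"
    unfolding uv using i c
    by (simp add: inner_diff_left inner_diff_right inner_commute algebra_simps)
  finally have "cos (a + b) \<le> x \<bullet> z" by (simp add: cos_add)
  then have "arccos (x \<bullet> z) \<le> arccos (cos (a + b))"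
    using inner_bounds_sphere[OF n(1,3)] by (intro arccos_le_arccos) auto
  also have "\<dots> = a + b" using True r ab by (intro arccos_cos) auto
  finally show ?thesis using n by (simp add: ab sdist_eq)
qed

interpretation hsphere: Metric_space "sphere (0::'a::real_inner) 1" sdist
proof
  fix x y z :: 'a
  show "0 \<le> sdist x y"
    using sdist_bounds(1)[of x y] by (cases "x \<in> sphere 0 1 \<and> y \<in> sphere 0 1") (auto simp: sdist_def)
  show "sdist x y = sdist y x" by (auto simp: sdist_def inner_commute)
  assume x: "x \<in> sphere 0 1" and y: "y \<in> sphere 0 1"
  show "sdist x y = 0 \<longleftrightarrow> x = y"
  proof
    assume "sdist x y = 0"
    then have "x \<bullet> y = 1" using cos_sdist[of x y] x y by simp
    then show "x = y" using sphere_eqI[of x y] x y by simp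
  next
    assume "x = y"
    then show "sdist x y = 0" using x by (simp add: sdist_eq norm_eq_1)
  qed
  assume "z \<in> sphere 0 1"
  then show "sdist x z \<le> sdist x y + sdist y z" using sdist_triangle x y by simp
qed

definition is_geodesic :: "(real \<Rightarrow> 'a::real_inner) \<Rightarrow> 'a \<Rightarrow> 'a \<Rightarrow> bool"
  where "is_geodesic c x y \<longleftrightarrow>
    c \<in> {0..sdist x y} \<rightarrow> sphere 0 1 \<and> c 0 = x \<and> c (sdist x y) = y \<and>
    (\<forall>s\<in>{0..sdist x y}. \<forall>t\<in>{0..sdist x y}. sdist (c s) (c t) = \<bar>s - t\<bar>)"

definition geodesic_segment :: "'a::real_inner \<Rightarrow> 'a \<Rightarrow> 'a set"
  where "geodesic_segment x y = (THE A. \<exists>c. is_geodesic c x y \<and> A = c ` {0..sdist x y})"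

lemma geodesic_formula:
  fixes x y :: "'a::real_inner"
  assumes n: "norm x = 1" "norm y = 1" and l: "l = sdist x y" "0 < l" "l < pi"
    and g: "is_geodesic c x y" and t: "t \<in> {0..l}"
  shows "c t = (1 / sin l) *\<^sub>R (sin (l - t) *\<^sub>R x + sin t *\<^sub>R y)"
proof -
  define w where "w = (1 / sin l) *\<^sub>R (sin (l - t) *\<^sub>R x + sin t *\<^sub>R y)"
  have sl: "sin l > 0" using l by (intro sin_gt_zero)
  have nc: "norm (c t) = 1" using g t l unfolding is_geodesic_def by auto
  have dist: "sdist (c s) (c s') = \<bar>s - s'\<bar>" if "s \<in> {0..l}" "s' \<in> {0..l}" for s s'
    using g that unfolding is_geodesic_def l(1) by blast
  have "sdist (c 0) (c t) = \<bar>0 - t\<bar>" "sdist (c t) (c l) = \<bar>t - l\<bar>"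
    using dist[of 0 t] dist[of t l] t l(2) by auto
  moreover have "c 0 = x" "c l = y" using g l unfolding is_geodesic_def by auto
  ultimately have "sdist x (c t) = t" "sdist (c t) y = l - t" using t by auto
  then have i: "x \<bullet> c t = cos t" "c t \<bullet> y = cos (l - t)"
    using cos_sdist n nc by metis+
  have xy: "x \<bullet> y = cos l" using cos_sdist[OF n] l by simp
  have ii: "x \<bullet> x = 1" "y \<bullet> y = 1" using n by (auto simp: norm_eq_1)
  have "w \<bullet> c t = (1 / sin l) * (sin (l - t) * cos t + sin t * cos (l - t))"
    unfolding w_def using i by (simp add: inner_add_left inner_add_right inner_commute)
  also have "sin (l - t) * cos t + sin t * cos (l - t) = sin l"
    using sin_add[of "l - t" t] by (simp add: algebra_simps)
  finally have wc: "w \<bullet> c t = 1" using sl by simp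
  have "w \<bullet> w = (1 / sin l)\<^sup>2 *
      ((sin (l - t))\<^sup>2 + (sin t)\<^sup>2 + 2 * sin (l - t) * sin t * cos l)"
    unfolding w_def using ii xy
    by (simp add: inner_add_left inner_add_right inner_commute power2_eq_square algebra_simps)
  also have "(sin (l - t))\<^sup>2 + (sin t)\<^sup>2 + 2 * sin (l - t) * sin t * cos l = (sin l)\<^sup>2"
    using sin_cos_squared_add[of l] sin_cos_squared_add[of t] unfolding sin_diff by algebra
  finally have "w \<bullet> w = 1" using sl by (simp add: power2_eq_square)
  then have "w = c t" using wc nc by (auto intro!: sphere_eqI[of w "c t"] simp: norm_eq_1)
  then show ?thesis by (simp add: w_def)
qed

lemma geodesic_exists:
  fixes x y :: "'a::real_inner"
  assumes n: "norm x = 1" "norm y = 1" and l: "sdist x y < pi"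
  shows "\<exists>c. is_geodesic c x y"
proof (cases "sdist x y = 0")
  case True
  then have "x = y" using hsphere.zero[of x y] n by simp
  then have "is_geodesic (\<lambda>_. x) x y" using True n by (auto simp: is_geodesic_def)
  then show ?thesis by blast
next
  case False
  define l where "l = sdist x y"
  have l0: "0 < l" "l < pi" using False l sdist_bounds(1)[OF n] unfolding l_def by linarith+
  have sl: "sin l > 0" using l0 by (intro sin_gt_zero)
  have xy: "x \<bullet> y = cos l" using cos_sdist[OF n] by (simp add: l_def)
  have ii: "x \<bullet> x = 1" "y \<bullet> y = 1" using n by (auto simp: norm_eq_1)
  define w where "w t = (1 / sin l) *\<^sub>R (sin (l - t) *\<^sub>R x + sin t *\<^sub>R y)" for t
  have ww: "w s \<bullet> w t = cos (s - t)" for s t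
  proof -
    have "w s \<bullet> w t = (1 / sin l)\<^sup>2 * (sin (l - s) * sin (l - t) + sin s * sin t
        + (sin (l - s) * sin t + sin s * sin (l - t)) * cos l)"
      unfolding w_def using ii xy
      by (simp add: inner_add_left inner_add_right inner_commute power2_eq_square algebra_simps)
    also have "sin (l - s) * sin (l - t) + sin s * sin t
        + (sin (l - s) * sin t + sin s * sin (l - t)) * cos l = (sin l)\<^sup>2 * cos (s - t)"
      using sin_cos_squared_add[of l] unfolding sin_diff cos_diff by algebra
    finally show ?thesis using sl by (simp add: power2_eq_square)
  qed
  have nw: "norm (w s) = 1" for s using ww[of s s] by (simp add: norm_eq_1)
  have "sdist (w s) (w t) = \<bar>s - t\<bar>" if "s \<in> {0..l}" "t \<in> {0..l}" for s t
  proof -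
    have "\<bar>s - t\<bar> \<le> pi" using that l0 by auto
    then show ?thesis using arccos_cos_eq_abs[of "s - t"] by (simp add: sdist_eq nw ww)
  qed
  then have "is_geodesic w x y"
    using nw sl unfolding is_geodesic_def l_def[symmetric] by (auto simp: w_def)
  then show ?thesis by blast
qed

lemma geodesic_segment_unique:
  fixes x y :: "'a::real_inner"
  assumes n: "norm x = 1" "norm y = 1" and l: "sdist x y < pi"
  shows "\<exists>!A. \<exists>c. is_geodesic c x y \<and> A = c ` {0..sdist x y}"
proof -
  have u: "c ` {0..sdist x y} = c' ` {0..sdist x y}"
    if "is_geodesic c x y" "is_geodesic c' x y" for c c'
  proof (cases "sdist x y = 0")
    case True
    then show ?thesis using that by (simp add: is_geodesic_def)
  next
    case False
    then have "0 < sdist x y" using sdist_bounds(1)[OF n] by linarith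
    then show ?thesis
      using geodesic_formula[OF n refl _ l that(1)] geodesic_formula[OF n refl _ l that(2)]
      by (intro image_cong) auto
  qed
  obtain c where c: "is_geodesic c x y" using geodesic_exists[OF n l] by blast
  show ?thesis
  proof (rule ex1I[of _ "c ` {0..sdist x y}"])
    show "\<exists>c'. is_geodesic c' x y \<and> c ` {0..sdist x y} = c' ` {0..sdist x y}"
      by (rule exI[of _ c]) (simp add: c)
  next
    fix A
    assume "\<exists>c. is_geodesic c x y \<and> A = c ` {0..sdist x y}"
    then obtain c' where c': "is_geodesic c' x y" and A: "A = c' ` {0..sdist x y}" by (elim exE conjE)
    show "A = c ` {0..sdist x y}" unfolding A by (rule u[OF c' c])
  qed
qed

lemma geodesic_segment_eq:
  fixes x y :: "'a::real_inner"
  assumes n: "norm x = 1" "norm y = 1" and l: "sdist x y < pi" and g: "is_geodesic c x y"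
  shows "geodesic_segment x y = c ` {0..sdist x y}"
  unfolding geodesic_segment_def
  by (rule the1_equality[OF geodesic_segment_unique[OF n l]], rule exI[of _ c]) (simp add: g)

definition geodesically_convex :: "'a::real_inner set \<Rightarrow> bool"
  where "geodesically_convex C \<longleftrightarrow> (\<forall>x\<in>C. \<forall>y\<in>C. geodesic_segment x y \<subseteq> C)"

text \<open>\<open>geodesic_comb \<alpha> x y\<close> is \<open>\<alpha>x \<oplus> (1 - \<alpha>)y\<close>; note that \<open>\<alpha>\<close> is the weight of \<open>x\<close>.\<close>

definition geodesic_comb :: "real \<Rightarrow> 'a::real_inner \<Rightarrow> 'a \<Rightarrow> 'a"
  where "geodesic_comb \<alpha> x y = (THE z. z \<in> geodesic_segment x y \<and>
    sdist y z = \<alpha> * sdist x y \<and> sdist x z = (1 - \<alpha>) * sdist x y)"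

lemma geodesic_comb_unique:
  fixes x y :: "'a::real_inner"
  assumes n: "norm x = 1" "norm y = 1" and l: "sdist x y < pi" and \<alpha>: "0 \<le> \<alpha>" "\<alpha> \<le> 1"
  shows "\<exists>!z. z \<in> geodesic_segment x y \<and>
    sdist y z = \<alpha> * sdist x y \<and> sdist x z = (1 - \<alpha>) * sdist x y"
proof -
  obtain c where c: "is_geodesic c x y" using geodesic_exists[OF n l] by blast
  define L where "L = sdist x y"
  have L0: "0 \<le> L" using sdist_bounds[OF n] by (simp add: L_def)
  have seg: "geodesic_segment x y = c ` {0..L}"
    unfolding L_def by (rule geodesic_segment_eq[OF n l c])
  have dist: "sdist (c s) (c t) = \<bar>s - t\<bar>" if "s \<in> {0..L}" "t \<in> {0..L}" for s t
    using c that unfolding is_geodesic_def L_def by blast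
  have ends: "c 0 = x" "c L = y" using c by (auto simp: is_geodesic_def L_def)
  have dx: "sdist x (c t) = t" if "t \<in> {0..L}" for t
    using dist[of 0 t] that L0 ends by auto
  have dy: "sdist y (c t) = L - t" if "t \<in> {0..L}" for t
    using dist[of L t] that L0 ends by auto
  have m: "(1 - \<alpha>) * L \<in> {0..L}" using \<alpha> L0 by (auto intro: mult_left_le_one_le)
  show ?thesis unfolding L_def[symmetric] seg
  proof (rule ex1I[of _ "c ((1 - \<alpha>) * L)"])
    show "c ((1 - \<alpha>) * L) \<in> c ` {0..L} \<and> sdist y (c ((1 - \<alpha>) * L)) = \<alpha> * L \<and>
        sdist x (c ((1 - \<alpha>) * L)) = (1 - \<alpha>) * L"
      using m dx[OF m] dy[OF m] by (auto simp: algebra_simps)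
  qed (use dx in auto)
qed

definition nonexpansive_on :: "'a::real_inner set \<Rightarrow> ('a \<Rightarrow> 'a) \<Rightarrow> bool"
  where "nonexpansive_on C T \<longleftrightarrow>
    T \<in> C \<rightarrow> C \<and> (\<forall>x\<in>C. \<forall>y\<in>C. sdist (T x) (T y) \<le> sdist x y)"

definition fixed_points :: "'a set \<Rightarrow> ('a \<Rightarrow> 'a) \<Rightarrow> 'a set"
  where "fixed_points C T = {z \<in> C. T z = z}"

text \<open>\<open>W_map T \<alpha> k\<close> is \<open>U\<^sub>k\<close>. Starting the recursion from \<open>U\<^sub>0 = I\<close> yields
  \<open>U\<^sub>1 = \<alpha>\<^sub>1T\<^sub>1 \<oplus> (1 - \<alpha>\<^sub>1)I\<close>; indices of \<open>T\<close> and \<open>\<alpha>\<close> start at 1.\<close>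

primrec W_map :: "(nat \<Rightarrow> 'a \<Rightarrow> 'a::real_inner) \<Rightarrow> (nat \<Rightarrow> real) \<Rightarrow> nat \<Rightarrow> 'a \<Rightarrow> 'a" where
  "W_map T \<alpha> 0 x = x"
| "W_map T \<alpha> (Suc k) x = geodesic_comb (\<alpha> (Suc k)) (T (Suc k) (W_map T \<alpha> k x)) x"

definition is_metric_proj :: "'a::real_inner set \<Rightarrow> 'a \<Rightarrow> 'a \<Rightarrow> bool"
  where "is_metric_proj K x p \<longleftrightarrow> p \<in> K \<and> sdist x p = (INF y\<in>K. sdist x y)"

definition metric_proj :: "'a::real_inner set \<Rightarrow> 'a \<Rightarrow> 'a"
  where "metric_proj K x = (THE p. is_metric_proj K x p)"

text \<open>The shrinking projection scheme for mappings \<open>W\<^sub>1, W\<^sub>2, \<dots>\<close> and starting point \<open>u = x\<^sub>1\<close>: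
  \<open>shrink_set W C u n\<close> is \<open>C\<^sub>n\<close> (\<open>n \<ge> 0\<close>) and \<open>shrink_seq W C u n\<close> is \<open>x\<^sub>n\<close> (\<open>n \<ge> 1\<close>), with
  \<open>W\<^sub>n x\<^sub>n\<close> in place of \<open>y\<^sub>n\<close>. The value at \<open>n = 0\<close> of the latter is a dummy.\<close>

fun shrink_set :: "(nat \<Rightarrow> 'a \<Rightarrow> 'a::real_inner) \<Rightarrow> 'a set \<Rightarrow> 'a \<Rightarrow> nat \<Rightarrow> 'a set"
  and shrink_seq :: "(nat \<Rightarrow> 'a \<Rightarrow> 'a::real_inner) \<Rightarrow> 'a set \<Rightarrow> 'a \<Rightarrow> nat \<Rightarrow> 'a" where
  "shrink_set W C u 0 = C"
| "shrink_set W C u (Suc n) =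
    (let x = shrink_seq W C u (Suc n); y = W (Suc n) x
     in {z \<in> C. sdist y z \<le> sdist x z} \<inter> shrink_set W C u n)"
| "shrink_seq W C u 0 = u"
| "shrink_seq W C u (Suc n) = (if n = 0 then u else metric_proj (shrink_set W C u n) u)"

end

theory Submission
  imports Defs
begin

text \<open>
  The whole argument is carried out with inner products. Since \<open>cos (sdist x y) = x \<bullet> y\<close>, being
  close to \<open>q\<close> means having a large inner product with \<open>q\<close>; on the sphere, metric convergence is norm
  convergence; and the set of points closer to \<open>y\<^sub>n\<close> than to \<open>x\<^sub>n\<close> is the trace of a half-space through
  the origin. All points of \<open>C\<close> have positive inner product with one another.

  One inequality, \<open>inner_geodesic_comb_ge\<close>, carries the proof. A point \<open>z = \<alpha>x \<oplus> (1 - \<alpha>)y\<close> of a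
  geodesic is a combination \<open>sx + ty\<close> with \<open>s \<ge> \<alpha>\<close> and \<open>t \<ge> 1 - \<alpha>\<close>, because the sine is concave. As \<open>z\<close>
  has norm 1, the sum \<open>s + t\<close> is at least 1, and exceeds 1 by a definite amount if \<open>x\<close> and \<open>y\<close> are far apart. Hence if
  \<open>q \<bullet> x\<close> and \<open>q \<bullet> y\<close> are at least \<open>L \<ge> 0\<close>, then
  \<open>(q \<bullet> z)\<^sup>2 \<ge> L\<^sup>2 (1 + \<alpha>(1 - \<alpha>) \<parallel>x - y\<parallel>\<^sup>2)\<close>: for \<open>L > 0\<close>, interior points of a geodesic are strictly
  closer to \<open>q\<close> than its farther end. This uniform convexity is used in two ways.

  First, with \<open>\<alpha> = 1/2\<close>, points of a convex set that nearly maximize \<open>q \<bullet> _\<close> are close to one another.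
  This gives the metric projections (\<open>metric_proj_ex1\<close>), and it makes \<open>x\<^sub>n\<close> a Cauchy sequence, because
  \<open>x\<^sub>n\<^sub>+\<^sub>1\<close> maximizes \<open>x\<^sub>1 \<bullet> _\<close> over the decreasing sets \<open>C\<^sub>n\<close>, whose maxima converge to a positive number: they
  are bounded below by \<open>x\<^sub>1 \<bullet> p\<close> for any \<open>p \<in> F\<close>, since \<open>F \<subseteq> C\<^sub>n\<close>. The limit \<open>l\<close> lies in every \<open>C\<^sub>n\<close>, so
  \<open>y\<^sub>n\<close> is at least as close to \<open>l\<close> as \<open>x\<^sub>n\<close> and converges to \<open>l\<close> too.

  Secondly, with \<open>q = p \<in> F\<close>, it shows that \<open>l\<close> is a common fixed point (\<open>W_map_limit_fixed\<close>): if one stage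
  \<open>U\<^sub>k x\<^sub>n\<close> of the W-mapping brings no gain in the inner product with \<open>p\<close> in the limit, then the two ends
  \<open>T\<^sub>k U\<^sub>k\<^sub>-\<^sub>1 x\<^sub>n\<close> and \<open>x\<^sub>n\<close> of its geodesic have the same limit \<open>l\<close>, and the previous stage brings no gain
  either. Descending from \<open>k = r\<close> to \<open>k = 1\<close> gives \<open>T\<^sub>k l = l\<close> for all \<open>k\<close>.

  Finally \<open>l\<close> maximizes \<open>x\<^sub>1 \<bullet> _\<close> over the closed convex set \<open>\<Inter>\<^sub>n C\<^sub>n\<close>, which contains \<open>F\<close>, and \<open>l \<in> F\<close>.
  So \<open>l\<close> is the projection onto that intersection as well as onto \<open>F\<close>, and the uniqueness of the former
  yields that of the latter.
\<close>

section \<open>Spherical distance and inner product\<close>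

lemma sdist_le_iff_inner:
  fixes x y x' y' :: "'a::real_inner"
  assumes "norm x = 1" "norm y = 1" "norm x' = 1" "norm y' = 1"
  shows "sdist x y \<le> sdist x' y' \<longleftrightarrow> x' \<bullet> y' \<le> x \<bullet> y"
  using assms inner_bounds_sphere[of x y] inner_bounds_sphere[of x' y']
  by (simp add: sdist_eq arccos_le_mono abs_le_iff)

lemma sdist_less_pi_half_iff:
  fixes x y :: "'a::real_inner"
  assumes "norm x = 1" "norm y = 1"
  shows "sdist x y < pi / 2 \<longleftrightarrow> 0 < x \<bullet> y"
  using arccos_less_mono[of "x \<bullet> y" 0] inner_bounds_sphere[OF assms]
  by (simp add: sdist_eq assms abs_le_iff)

lemma norm_diff_sphere:
  fixes x y :: "'a::real_inner"
  assumes "norm x = 1" "norm y = 1"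
  shows "(norm (x - y))\<^sup>2 = 2 - 2 * (x \<bullet> y)"
  using assms unfolding power2_norm_eq_inner
  by (simp add: inner_diff_left inner_diff_right inner_commute norm_eq_1)

lemma norm_diff_le_iff_sdist:
  fixes x y x' y' :: "'a::real_inner"
  assumes "norm x = 1" "norm y = 1" "norm x' = 1" "norm y' = 1"
  shows "norm (x - y) \<le> norm (x' - y') \<longleftrightarrow> sdist x y \<le> sdist x' y'"
proof -
  have "norm (x - y) \<le> norm (x' - y') \<longleftrightarrow> (norm (x - y))\<^sup>2 \<le> (norm (x' - y'))\<^sup>2"
    by (simp add: abs_le_square_iff [symmetric])
  then show ?thesis
    using assms by (simp add: norm_diff_sphere sdist_le_iff_inner)
qed

lemma tendsto_norm_dominated:
  fixes f :: "'b \<Rightarrow> 'a::real_normed_vector" and g :: "'b \<Rightarrow> 'c::real_normed_vector"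
  assumes le: "\<And>n. norm (f n - l) \<le> norm (g n - m)" and g: "(g \<longlongrightarrow> m) G"
  shows "(f \<longlongrightarrow> l) G"
proof (rule tendstoI)
  fix e :: real assume "0 < e"
  with g have "\<forall>\<^sub>F n in G. dist (g n) m < e" by (rule tendstoD)
  then show "\<forall>\<^sub>F n in G. dist (f n) l < e"
    by (rule eventually_mono) (metis le dist_norm le_less_trans)
qed

lemma tendsto_iff_sdist:
  fixes f :: "'b \<Rightarrow> 'a::real_inner"
  assumes f: "\<And>n. norm (f n) = 1" and l: "norm l = 1"
  shows "((\<lambda>n. sdist (f n) l) \<longlongrightarrow> 0) G \<longleftrightarrow> (f \<longlongrightarrow> l) G"
proof
  assume "((\<lambda>n. sdist (f n) l) \<longlongrightarrow> 0) G"
  moreover have "isCont cos (0::real)" by simp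
  ultimately have "((\<lambda>n. cos (sdist (f n) l)) \<longlongrightarrow> cos 0) G"
    by (rule isCont_tendsto_compose[rotated])
  then have "((\<lambda>n. f n \<bullet> l) \<longlongrightarrow> 1) G"
    by (simp add: cos_sdist f l)
  then have "((\<lambda>n. sqrt (2 - 2 * (f n \<bullet> l))) \<longlongrightarrow> sqrt (2 - 2 * 1)) G"
    by (intro tendsto_intros)
  moreover have "norm (f n - l) = sqrt (2 - 2 * (f n \<bullet> l))" for n
    using norm_diff_sphere[OF f[of n] l] by (metis norm_ge_zero real_sqrt_unique)
  ultimately have "((\<lambda>n. norm (f n - l)) \<longlongrightarrow> 0) G"
    by simp
  then show "(f \<longlongrightarrow> l) G"
    by (rule LIM_zero_cancel[OF tendsto_norm_zero_cancel])
next
  assume "(f \<longlongrightarrow> l) G"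
  then have "((\<lambda>n. f n \<bullet> l) \<longlongrightarrow> l \<bullet> l) G"
    by (intro tendsto_intros)
  then have *: "((\<lambda>n. f n \<bullet> l) \<longlongrightarrow> 1) G"
    using l by (simp add: norm_eq_1)
  have "((\<lambda>n. arccos (f n \<bullet> l)) \<longlongrightarrow> arccos 1) G"
    by (rule continuous_on_tendsto_compose[OF continuous_on_arccos' *])
       (use inner_bounds_sphere[OF f l] in auto)
  then show "((\<lambda>n. sdist (f n) l) \<longlongrightarrow> 0) G"
    by (simp add: sdist_eq f l)
qed

lemma limitin_sphere_iff:
  fixes f :: "nat \<Rightarrow> 'a::real_inner"
  assumes "\<And>n. norm (f n) = 1" "norm l = 1"
  shows "limitin hsphere.mtopology f l sequentially \<longleftrightarrow> f \<longlonglongrightarrow> l"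
  unfolding hsphere.limitin_metric_dist_null using assms tendsto_iff_sdist[of f l] by simp

lemma closedin_sphere_iff:
  fixes K :: "'a::real_inner set"
  assumes K: "K \<subseteq> sphere 0 1"
  shows "closedin hsphere.mtopology K \<longleftrightarrow> closed K"
proof
  assume cl: "closedin hsphere.mtopology K"
  show "closed K"
    unfolding closed_sequential_limits
  proof (intro allI impI, elim conjE)
    fix f l assume f: "\<forall>n. f n \<in> K" and lim: "f \<longlonglongrightarrow> l"
    have nf: "norm (f n) = 1" for n using f K by auto
    have "(\<lambda>n. norm (f n)) \<longlonglongrightarrow> norm l" by (intro tendsto_norm lim)
    then have "norm l = 1" using nf by (simp add: LIMSEQ_const_iff)
    then have "limitin hsphere.mtopology f l sequentially"
      using limitin_sphere_iff nf lim by blast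
    then show "l \<in> K"
      using cl f unfolding hsphere.metric_closedin_iff_sequentially_closed by blast
  qed
next
  assume cl: "closed K"
  show "closedin hsphere.mtopology K"
    unfolding hsphere.metric_closedin_iff_sequentially_closed
  proof (intro conjI allI impI K, elim conjE)
    fix f :: "nat \<Rightarrow> 'a" and l
    assume f: "range f \<subseteq> K" and lim: "limitin hsphere.mtopology f l sequentially"
    have nf: "norm (f n) = 1" for n
    proof -
      have "f n \<in> K" using f by blast
      then show ?thesis using K by auto
    qed
    have "norm l = 1" using lim unfolding hsphere.limitin_metric_dist_null by simp
    then have "f \<longlonglongrightarrow> l" using limitin_sphere_iff[of f l] nf lim by simp
    then show "l \<in> K" using cl f unfolding closed_sequential_limits by blast
  qed
qed

section \<open>Geodesics as conical combinations\<close>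

lemma sin_mult_ge:
  assumes "0 \<le> \<beta>" "\<beta> \<le> 1" "0 \<le> l" "l \<le> pi"
  shows "\<beta> * sin l \<le> sin (\<beta> * l)"
proof -
  have "concave_on {0..pi} sin"
    by (rule f''_le0_imp_concave[where f' = cos and f'' = "\<lambda>x. - sin x"])
       (auto intro!: derivative_eq_intros sin_ge_zero)
  from concave_onD[OF this, of \<beta> 0 l] assms show ?thesis
    by simp
qed

text \<open>The coefficients of a point of a geodesic of length \<open>l\<close> are \<open>sin (\<beta> l) / sin l\<close> and
  \<open>sin ((1 - \<beta>) l) / sin l\<close>. Only their lower bounds are recorded: together with \<open>norm z = 1\<close> they
  suffice for the estimates below, and they make sense also for \<open>x = y\<close>, where the quotients do not.\<close>

lemma geodesic_segment_mem_cone: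
  fixes x y z :: "'a::real_inner"
  assumes n: "norm x = 1" "norm y = 1" and l: "sdist x y < pi"
    and \<beta>: "0 \<le> \<beta>" "\<beta> \<le> 1"
    and z: "z \<in> geodesic_segment x y" "sdist x z = (1 - \<beta>) * sdist x y"
  shows "norm z = 1 \<and> (\<exists>s t. \<beta> \<le> s \<and> 1 - \<beta> \<le> t \<and> z = s *\<^sub>R x + t *\<^sub>R y)"
proof -
  obtain c where c: "is_geodesic c x y" using geodesic_exists[OF n l] by blast
  define L where "L = sdist x y"
  have seg: "geodesic_segment x y = c ` {0..L}"
    unfolding L_def by (rule geodesic_segment_eq[OF n l c])
  obtain \<tau> where \<tau>: "\<tau> \<in> {0..L}" "z = c \<tau>" using z(1) seg by auto
  have nz: "norm z = 1" using \<tau> c unfolding is_geodesic_def L_def by auto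
  have L0: "0 \<le> L" using \<tau>(1) by simp
  show ?thesis
  proof (cases "L = 0")
    case True
    then have "x = y" "z = x"
      using hsphere.zero[of x y] n \<tau> c by (auto simp: L_def is_geodesic_def)
    then have "z = \<beta> *\<^sub>R x + (1 - \<beta>) *\<^sub>R y" by (simp add: algebra_simps)
    then show ?thesis using nz by blast
  next
    case False
    then have Lpos: "0 < L" "L < pi" using L0 l by (simp_all add: L_def[symmetric])
    have sl: "0 < sin L" using Lpos by (rule sin_gt_zero)
    have "sdist (c 0) (c \<tau>) = \<bar>0 - \<tau>\<bar>"
      using c \<tau>(1) L0 unfolding is_geodesic_def L_def[symmetric] by auto
    then have "\<tau> = sdist x z" using c \<tau> by (simp add: is_geodesic_def)
    then have \<tau>_eq: "\<tau> = (1 - \<beta>) * L" and "L - \<tau> = \<beta> * L"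
      using z(2) by (simp_all add: L_def algebra_simps)
    with geodesic_formula[OF n L_def Lpos c \<tau>(1)] \<tau>(2)
    have "z = (sin (\<beta> * L) / sin L) *\<^sub>R x + (sin ((1 - \<beta>) * L) / sin L) *\<^sub>R y"
      by (simp add: scaleR_add_right)
    moreover have "\<beta> \<le> sin (\<beta> * L) / sin L" "1 - \<beta> \<le> sin ((1 - \<beta>) * L) / sin L"
      using sin_mult_ge[of \<beta> L] sin_mult_ge[of "1 - \<beta>" L] \<beta> Lpos sl
      by (simp_all add: pos_le_divide_eq)
    ultimately show ?thesis using nz by blast
  qed
qed

lemma geodesic_segmentE:
  fixes x y z :: "'a::real_inner"
  assumes n: "norm x = 1" "norm y = 1" and l: "sdist x y < pi"
    and z: "z \<in> geodesic_segment x y"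
  obtains s t where "norm z = 1" "0 \<le> s" "0 \<le> t" "z = s *\<^sub>R x + t *\<^sub>R y"
proof -
  obtain c where c: "is_geodesic c x y" using geodesic_exists[OF n l] by blast
  obtain \<tau> where \<tau>: "\<tau> \<in> {0..sdist x y}" "z = c \<tau>"
    using z geodesic_segment_eq[OF n l c] by auto
  have "sdist (c 0) (c \<tau>) = \<bar>0 - \<tau>\<bar>"
    using c \<tau>(1) unfolding is_geodesic_def by (metis atLeastAtMost_iff order.refl order.trans)
  then have "sdist x z = \<tau>" using c \<tau> by (simp add: is_geodesic_def)
  then have d: "0 \<le> sdist x z" "sdist x z \<le> sdist x y" using \<tau>(1) by auto
  have "\<exists>\<beta>. 0 \<le> \<beta> \<and> \<beta> \<le> 1 \<and> sdist x z = (1 - \<beta>) * sdist x y"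
  proof (cases "sdist x y = 0")
    case True
    then have "sdist x z = 0" using d by linarith
    then show ?thesis using True by (intro exI[of _ 0]) simp
  next
    case False
    then have "0 < sdist x y" using d by linarith
    then show ?thesis
      using d by (intro exI[of _ "1 - sdist x z / sdist x y"]) simp
  qed
  then obtain \<beta> where \<beta>: "0 \<le> \<beta>" "\<beta> \<le> 1" "sdist x z = (1 - \<beta>) * sdist x y" by blast
  from geodesic_segment_mem_cone[OF n l \<beta>(1,2) z \<beta>(3)] obtain s t
    where "norm z = 1" "\<beta> \<le> s" "1 - \<beta> \<le> t" "z = s *\<^sub>R x + t *\<^sub>R y" by blast
  with \<beta>(1,2) show ?thesis by (intro that[of s t]) auto
qed

lemma geodesic_comb_in_segment:
  fixes x y :: "'a::real_inner"
  assumes "norm x = 1" "norm y = 1" "sdist x y < pi" "0 \<le> \<alpha>" "\<alpha> \<le> 1"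
  shows "geodesic_comb \<alpha> x y \<in> geodesic_segment x y"
    and "sdist y (geodesic_comb \<alpha> x y) = \<alpha> * sdist x y"
    and "sdist x (geodesic_comb \<alpha> x y) = (1 - \<alpha>) * sdist x y"
  using theI'[OF geodesic_comb_unique[OF assms]] unfolding geodesic_comb_def by blast+

text \<open>With \<open>z = s x + t y\<close> one has \<open>q \<bullet> z \<ge> (s + t) L\<close>, while \<open>norm z = 1\<close> expands to
  \<open>(s + t)\<^sup>2 = 1 + s t \<parallel>x - y\<parallel>\<^sup>2\<close>, where \<open>s t \<ge> \<alpha> (1 - \<alpha>)\<close>.\<close>

lemma inner_geodesic_comb_ge:
  fixes x y q :: "'a::real_inner"
  assumes n: "norm x = 1" "norm y = 1" and d: "sdist x y < pi"
    and \<alpha>: "0 \<le> \<alpha>" "\<alpha> \<le> 1"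
    and L: "0 \<le> L" "L \<le> q \<bullet> x" "L \<le> q \<bullet> y"
  shows "L\<^sup>2 * (1 + \<alpha> * (1 - \<alpha>) * (norm (x - y))\<^sup>2) \<le> (q \<bullet> geodesic_comb \<alpha> x y)\<^sup>2"
    and "L \<le> q \<bullet> geodesic_comb \<alpha> x y"
proof -
  define z where "z = geodesic_comb \<alpha> x y"
  obtain s t where nz: "norm z = 1" and st: "\<alpha> \<le> s" "1 - \<alpha> \<le> t" and z: "z = s *\<^sub>R x + t *\<^sub>R y"
    using geodesic_segment_mem_cone[OF n d \<alpha>] geodesic_comb_in_segment(1,3)[OF n d \<alpha>]
    unfolding z_def by blast
  have "s * L + t * L \<le> s * (q \<bullet> x) + t * (q \<bullet> y)"
    using L st \<alpha> by (intro add_mono mult_left_mono) auto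
  then have qz: "(s + t) * L \<le> q \<bullet> z"
    unfolding z by (simp add: inner_add_right distrib_right)
  have "1 = z \<bullet> z" using nz by (simp add: norm_eq_1)
  also have "\<dots> = s\<^sup>2 + t\<^sup>2 + 2 * s * t * (x \<bullet> y)"
    using n unfolding z norm_eq_1
    by (simp add: inner_add_left inner_add_right inner_commute power2_eq_square)
  finally have "(s + t)\<^sup>2 = 1 + s * t * (norm (x - y))\<^sup>2"
    unfolding norm_diff_sphere[OF n] by (simp add: power2_eq_square algebra_simps)
  moreover have "\<alpha> * (1 - \<alpha>) \<le> s * t" using st \<alpha> by (intro mult_mono) auto
  ultimately have "1 + \<alpha> * (1 - \<alpha>) * (norm (x - y))\<^sup>2 \<le> (s + t)\<^sup>2"
    by (simp add: mult_right_mono)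
  then have "L\<^sup>2 * (1 + \<alpha> * (1 - \<alpha>) * (norm (x - y))\<^sup>2) \<le> L\<^sup>2 * (s + t)\<^sup>2"
    by (rule mult_left_mono) simp
  also have "\<dots> = ((s + t) * L)\<^sup>2" by (simp add: power_mult_distrib)
  also have "\<dots> \<le> (q \<bullet> z)\<^sup>2" using qz st \<alpha> L by (intro power_mono) auto
  finally show "L\<^sup>2 * (1 + \<alpha> * (1 - \<alpha>) * (norm (x - y))\<^sup>2) \<le> (q \<bullet> geodesic_comb \<alpha> x y)\<^sup>2"
    by (simp add: z_def)
  have "1 * L \<le> (s + t) * L" using st L by (intro mult_right_mono) auto
  then show "L \<le> q \<bullet> geodesic_comb \<alpha> x y" using qz by (simp add: z_def)
qed

section \<open>Acute sets and their metric projections\<close>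

text \<open>The diameter of an acute set may equal \<open>\<pi> / 2\<close>, so inner products of its points are positive
  without being bounded away from \<open>0\<close>.\<close>

definition acute :: "'a::real_inner set \<Rightarrow> bool"
  where "acute C \<longleftrightarrow> C \<subseteq> sphere 0 1 \<and> (\<forall>x\<in>C. \<forall>y\<in>C. sdist x y < pi / 2)"

lemma acuteD:
  assumes "acute C"
  shows "x \<in> C \<Longrightarrow> norm x = 1"
    and "x \<in> C \<Longrightarrow> y \<in> C \<Longrightarrow> 0 < x \<bullet> y"
    and "x \<in> C \<Longrightarrow> y \<in> C \<Longrightarrow> sdist x y < pi"
proof -
  show n: "norm x = 1" if "x \<in> C" for x using assms that by (auto simp: acute_def)
  show "0 < x \<bullet> y" if "x \<in> C" "y \<in> C"
    using assms that n sdist_less_pi_half_iff[of x y] by (auto simp: acute_def)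
  show "sdist x y < pi" if "x \<in> C" "y \<in> C"
  proof -
    have "sdist x y < pi / 2" using assms that by (simp add: acute_def)
    then show ?thesis using pi_gt_zero by linarith
  qed
qed

lemma acute_subset: "acute C \<Longrightarrow> K \<subseteq> C \<Longrightarrow> acute K"
  unfolding acute_def by blast

lemma geodesic_comb_mem:
  assumes "acute C" "geodesically_convex C" "x \<in> C" "y \<in> C" "0 \<le> \<alpha>" "\<alpha> \<le> 1"
  shows "geodesic_comb \<alpha> x y \<in> C"
proof -
  have "geodesic_comb \<alpha> x y \<in> geodesic_segment x y"
    using assms by (intro geodesic_comb_in_segment acuteD[OF assms(1)])
  then show ?thesis using assms unfolding geodesically_convex_def by blast
qed

lemma geodesically_convex_Int:
  "geodesically_convex A \<Longrightarrow> geodesically_convex B \<Longrightarrow> geodesically_convex (A \<inter> B)"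
  unfolding geodesically_convex_def by blast

lemma geodesically_convex_INT:
  assumes "\<And>i. i \<in> I \<Longrightarrow> geodesically_convex (A i)"
  shows "geodesically_convex (\<Inter>i\<in>I. A i)"
  unfolding geodesically_convex_def
proof (intro ballI INT_greatest)
  fix x y i assume "x \<in> (\<Inter>i\<in>I. A i)" "y \<in> (\<Inter>i\<in>I. A i)" "i \<in> I"
  then have "x \<in> A i" "y \<in> A i" by simp_all
  then show "geodesic_segment x y \<subseteq> A i"
    using assms[OF \<open>i \<in> I\<close>] by (simp add: geodesically_convex_def)
qed

lemma closer_set_eq_halfspace:
  fixes C :: "'a::real_inner set"
  assumes C: "acute C" and n: "norm u = 1" "norm v = 1"
  shows "{z \<in> C. sdist u z \<le> sdist v z} = C \<inter> {z. (v - u) \<bullet> z \<le> 0}"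
proof -
  have "sdist u z \<le> sdist v z \<longleftrightarrow> (v - u) \<bullet> z \<le> 0" if "z \<in> C" for z
    using that acuteD(1)[OF C that] n by (simp add: sdist_le_iff_inner inner_diff_left)
  then show ?thesis by blast
qed

lemma geodesically_convex_Int_halfspace:
  fixes C :: "'a::real_inner set"
  assumes C: "acute C" and conv: "geodesically_convex C"
  shows "geodesically_convex (C \<inter> {z. w \<bullet> z \<le> 0})"
  unfolding geodesically_convex_def
proof (intro ballI subsetI)
  fix x y z assume x: "x \<in> C \<inter> {z. w \<bullet> z \<le> 0}" and y: "y \<in> C \<inter> {z. w \<bullet> z \<le> 0}"
    and z: "z \<in> geodesic_segment x y"
  obtain s t where "0 \<le> s" "0 \<le> t" "z = s *\<^sub>R x + t *\<^sub>R y"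
    using geodesic_segmentE[of x y z] acuteD(1,3)[OF C] x y z by blast
  then have "w \<bullet> z \<le> 0"
    using x y by (simp add: inner_add_right add_nonpos_nonpos mult_nonneg_nonpos)
  then show "z \<in> C \<inter> {z. w \<bullet> z \<le> 0}"
    using conv x y z unfolding geodesically_convex_def by blast
qed

text \<open>Since \<^const>\<open>arccos\<close> is decreasing, minimizing the distance to \<open>q\<close> is maximizing a linear
  functional.\<close>

lemma is_metric_proj_iff_inner:
  fixes K :: "'a::real_inner set"
  assumes K: "K \<subseteq> sphere 0 1" and q: "norm q = 1"
  shows "is_metric_proj K q p \<longleftrightarrow> p \<in> K \<and> (\<forall>w\<in>K. q \<bullet> w \<le> q \<bullet> p)"
proof (cases "p \<in> K")
  case True
  have n: "norm w = 1" if "w \<in> K" for w using K that by auto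
  have bdd: "bdd_below (sdist q ` K)"
    using sdist_bounds(1) n q by (intro bdd_belowI2[where m = 0]) auto
  have "sdist q p = (INF w\<in>K. sdist q w) \<longleftrightarrow> (\<forall>w\<in>K. sdist q p \<le> sdist q w)"
  proof
    assume "sdist q p = (INF w\<in>K. sdist q w)"
    then show "\<forall>w\<in>K. sdist q p \<le> sdist q w" using cINF_lower[OF bdd] by simp
  next
    assume "\<forall>w\<in>K. sdist q p \<le> sdist q w"
    then show "sdist q p = (INF w\<in>K. sdist q w)"
      using True by (intro antisym cINF_greatest cINF_lower bdd) auto
  qed
  then show ?thesis
    using True n q by (auto simp: is_metric_proj_def sdist_le_iff_inner)
qed (simp add: is_metric_proj_def)

text \<open>The midpoint of \<open>z m\<close> and \<open>z n\<close> lies in an earlier set \<open>K N\<close>, so its inner product with \<open>q\<close> is at most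
  \<open>M N\<close>; by uniform convexity this leaves no room for \<open>z m\<close> and \<open>z n\<close> to be far apart. Constant \<open>K\<close>
  gives the existence of projections, decreasing \<open>K\<close> the convergence of the shrinking scheme.\<close>

lemma near_maximizers_Cauchy:
  fixes C :: "'a::real_inner set" and K :: "nat \<Rightarrow> 'a set"
  assumes C: "acute C" and KC: "\<And>n. K n \<subseteq> C"
    and conv: "\<And>n. geodesically_convex (K n)" and dec: "decseq K"
    and z: "\<And>n. z n \<in> K n" and M: "\<And>n w. w \<in> K n \<Longrightarrow> q \<bullet> w \<le> M n"
    and M_lim: "M \<longlonglongrightarrow> L" and z_lim: "(\<lambda>n. q \<bullet> z n) \<longlonglongrightarrow> L" and L: "0 < L"
  shows "Cauchy z"
proof (rule metric_CauchyI)
  fix e :: real assume e: "0 < e"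
  \<comment> \<open>The slack \<open>\<delta>\<close> around \<open>L\<close> must be too small for points at distance \<open>e\<close>: at \<open>\<delta> = 0\<close> the inequality
    needed is strict because \<open>L > 0\<close>. The factor \<open>1 / 4\<close> is \<open>\<alpha> (1 - \<alpha>)\<close> at the midpoint.\<close>
  have "((\<lambda>\<delta>. (L + \<delta>)\<^sup>2 - (L - \<delta>)\<^sup>2 * (1 + e\<^sup>2 / 4)) \<longlongrightarrow> (L + 0)\<^sup>2 - (L - 0)\<^sup>2 * (1 + e\<^sup>2 / 4)) (at_right 0)"
    by (intro tendsto_intros)
  moreover have "(L + 0)\<^sup>2 - (L - 0)\<^sup>2 * (1 + e\<^sup>2 / 4) < 0"
    using L e by (simp add: algebra_simps)
  ultimately have "\<forall>\<^sub>F \<delta> in at_right 0. (L + \<delta>)\<^sup>2 - (L - \<delta>)\<^sup>2 * (1 + e\<^sup>2 / 4) < 0"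
    by (rule order_tendstoD(2))
  moreover have "\<forall>\<^sub>F \<delta> in at_right 0. \<delta> \<in> {0<..<L}"
    using L by (rule eventually_at_right_real)
  ultimately have "\<forall>\<^sub>F \<delta> in at_right 0. (L + \<delta>)\<^sup>2 < (L - \<delta>)\<^sup>2 * (1 + e\<^sup>2 / 4) \<and> \<delta> \<in> {0<..<L}"
    by eventually_elim simp
  then obtain \<delta> where "(L + \<delta>)\<^sup>2 < (L - \<delta>)\<^sup>2 * (1 + e\<^sup>2 / 4) \<and> \<delta> \<in> {0<..<L}"
    using eventually_happens'[OF trivial_limit_at_right_real] by blast
  then have \<delta>: "0 < \<delta>" "\<delta> < L" "(L + \<delta>)\<^sup>2 < (L - \<delta>)\<^sup>2 * (1 + e\<^sup>2 / 4)"
    by auto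
  have "\<forall>\<^sub>F n in sequentially. M n < L + \<delta> \<and> L - \<delta> < q \<bullet> z n"
    using order_tendstoD(2)[OF M_lim, of "L + \<delta>"] order_tendstoD(1)[OF z_lim, of "L - \<delta>"] \<delta>(1)
    by (simp add: eventually_conj)
  then obtain N where N: "M n < L + \<delta>" "L - \<delta> < q \<bullet> z n" if "N \<le> n" for n
    unfolding eventually_sequentially by blast
  have "dist (z m) (z n) < e" if mn: "N \<le> m" "N \<le> n" for m n
  proof -
    have zK: "z m \<in> K N" "z n \<in> K N" using z dec mn unfolding decseq_def by blast+
    have zC: "z m \<in> C" "z n \<in> C" using zK KC by blast+
    define u where "u = geodesic_comb (1/2) (z m) (z n)"
    have "u \<in> K N"
      unfolding u_def using acute_subset[OF C KC] conv zK by (intro geodesic_comb_mem) auto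
    then have ub: "q \<bullet> u < L + \<delta>" using M N(1)[of N] by fastforce
    note ge = inner_geodesic_comb_ge[of "z m" "z n" "1/2" "L - \<delta>" q, folded u_def]
    have lb: "(L - \<delta>)\<^sup>2 * (1 + 1/2 * (1 - 1/2) * (norm (z m - z n))\<^sup>2) \<le> (q \<bullet> u)\<^sup>2" "L - \<delta> \<le> q \<bullet> u"
      using ge acuteD(1,3)[OF C] zC N(2) mn \<delta> by (auto simp: less_imp_le)
    have "(q \<bullet> u)\<^sup>2 \<le> (L + \<delta>)\<^sup>2" using ub lb(2) \<delta> by (intro power_mono) auto
    with lb(1) \<delta>(3)
    have "(L - \<delta>)\<^sup>2 * (1 + 1/2 * (1 - 1/2) * (norm (z m - z n))\<^sup>2) < (L - \<delta>)\<^sup>2 * (1 + e\<^sup>2 / 4)"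
      by linarith
    then have "(norm (z m - z n))\<^sup>2 < e\<^sup>2" using \<delta>(2) by simp
    then show ?thesis using e by (simp add: dist_norm power2_less_imp_less)
  qed
  then show "\<exists>N. \<forall>m\<ge>N. \<forall>n\<ge>N. dist (z m) (z n) < e" by blast
qed

lemma metric_proj_unique:
  fixes K :: "'a::real_inner set"
  assumes K: "acute K" and conv: "geodesically_convex K" and q: "norm q = 1"
    and pos: "\<And>w. w \<in> K \<Longrightarrow> 0 < q \<bullet> w"
    and p: "is_metric_proj K q p" and p': "is_metric_proj K q p'"
  shows "p = p'"
proof -
  have KS: "K \<subseteq> sphere 0 1" using K by (simp add: acute_def)
  have pK: "p \<in> K" "p' \<in> K" and max: "\<And>w. w \<in> K \<Longrightarrow> q \<bullet> w \<le> q \<bullet> p" and eq: "q \<bullet> p' = q \<bullet> p"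
    using p p' by (auto simp: is_metric_proj_iff_inner[OF KS q] intro: antisym)
  define u where "u = geodesic_comb (1/2) p p'"
  have "u \<in> K" unfolding u_def using K conv pK by (intro geodesic_comb_mem) auto
  have L: "0 < q \<bullet> p" using pos pK(1) .
  note ge = inner_geodesic_comb_ge[of p p' "1/2" "q \<bullet> p" q, folded u_def]
  have lb: "(q \<bullet> p)\<^sup>2 * (1 + 1/2 * (1 - 1/2) * (norm (p - p'))\<^sup>2) \<le> (q \<bullet> u)\<^sup>2" "q \<bullet> p \<le> q \<bullet> u"
    using ge acuteD(1,3)[OF K] pK eq L by (auto simp: less_imp_le)
  then have "(q \<bullet> p)\<^sup>2 * (1 + 1/2 * (1 - 1/2) * (norm (p - p'))\<^sup>2) \<le> (q \<bullet> p)\<^sup>2 * 1"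
    using max[OF \<open>u \<in> K\<close>] by simp
  then have "(norm (p - p'))\<^sup>2 \<le> 0" using L by (subst (asm) mult_le_cancel_left_pos) auto
  then show ?thesis by simp
qed

lemma metric_proj_ex1:
  fixes K :: "'a::{real_inner, complete_space} set"
  assumes K: "acute K" and cl: "closed K" and conv: "geodesically_convex K" and ne: "K \<noteq> {}"
    and q: "norm q = 1" and pos: "\<And>w. w \<in> K \<Longrightarrow> 0 < q \<bullet> w"
  shows "\<exists>!p. is_metric_proj K q p"
proof -
  have KS: "K \<subseteq> sphere 0 1" using K by (simp add: acute_def)
  define M where "M = (SUP w\<in>K. q \<bullet> w)"
  have bdd: "bdd_above ((\<bullet>) q ` K)"
    using inner_bounds_sphere(2)[OF q] KS by (intro bdd_aboveI2[where M = 1]) auto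
  have le_M: "q \<bullet> w \<le> M" if "w \<in> K" for w
    unfolding M_def using bdd that by (rule cSUP_upper2) simp
  have Mpos: "0 < M" using ne pos le_M by (metis ex_in_conv less_le_trans)
  have "\<exists>w\<in>K. M - 1 / real (Suc n) < q \<bullet> w" for n
  proof -
    have "M - 1 / real (Suc n) < (SUP w\<in>K. q \<bullet> w)" by (simp add: M_def)
    then show ?thesis using less_cSUP_iff[OF ne bdd] by blast
  qed
  then obtain z where z: "\<And>n. z n \<in> K" "\<And>n. M - 1 / real (Suc n) < q \<bullet> z n" by metis
  have "(\<lambda>n. M - 1 / real (Suc n)) \<longlonglongrightarrow> M - 0"
    by (intro tendsto_intros LIMSEQ_Suc[OF lim_1_over_n])
  then have "(\<lambda>n. M - 1 / real (Suc n)) \<longlonglongrightarrow> M" by simp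
  then have z_lim: "(\<lambda>n. q \<bullet> z n) \<longlonglongrightarrow> M"
    by (rule tendsto_sandwich[rotated 2, OF _ tendsto_const])
       (intro always_eventually allI less_imp_le[OF z(2)] le_M[OF z(1)])+
  have "Cauchy z"
    by (rule near_maximizers_Cauchy[where K = "\<lambda>_. K" and C = K and M = "\<lambda>_. M" and q = q and L = M])
       (use K conv z(1) le_M z_lim Mpos in \<open>auto simp: decseq_def\<close>)
  then obtain p where p: "z \<longlonglongrightarrow> p" using Cauchy_convergent convergent_def by blast
  have pK: "p \<in> K" using cl z(1) p unfolding closed_sequential_limits by blast
  have "(\<lambda>n. q \<bullet> z n) \<longlonglongrightarrow> q \<bullet> p" using p by (intro tendsto_intros)
  then have "q \<bullet> p = M" using z_lim LIMSEQ_unique by blast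
  then have "is_metric_proj K q p" using pK le_M by (simp add: is_metric_proj_iff_inner[OF KS q])
  then show ?thesis using metric_proj_unique[OF K conv q pos] by blast
qed

section \<open>W-mappings and common fixed points\<close>

lemma W_map_mem:
  assumes C: "acute C" "geodesically_convex C"
    and T: "\<And>i. i \<in> {1..k} \<Longrightarrow> T i \<in> C \<rightarrow> C" and \<alpha>: "\<And>i. i \<in> {1..k} \<Longrightarrow> \<alpha> i \<in> {0..1}"
    and x: "x \<in> C"
  shows "W_map T \<alpha> k x \<in> C"
  using T \<alpha>
proof (induction k)
  case (Suc k)
  then have "W_map T \<alpha> k x \<in> C" "T (Suc k) \<in> C \<rightarrow> C" "\<alpha> (Suc k) \<in> {0..1}" by auto
  then show ?case using geodesic_comb_mem[OF C] x by auto
qed (simp add: x)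

lemma nonexpansive_on_inner_fixed:
  assumes C: "acute C" and T: "nonexpansive_on C T" and p: "p \<in> fixed_points C T" and u: "u \<in> C"
  shows "p \<bullet> u \<le> p \<bullet> T u"
proof -
  have pC: "p \<in> C" "T p = p" using p by (auto simp: fixed_points_def)
  have "T u \<in> C" "sdist (T p) (T u) \<le> sdist p u"
    using T u pC by (auto simp: nonexpansive_on_def)
  then show ?thesis
    using pC acuteD(1)[OF C] u by (simp add: sdist_le_iff_inner)
qed

text \<open>This puts the common fixed points inside the sets \<open>C\<^sub>n\<close>. Each \<open>T i\<close> moves no point away from its fixed
  points, and a geodesic from \<open>T i u\<close> to \<open>x\<close> stays at least as close to \<open>p\<close> as its farther end.\<close>

lemma W_map_inner_fixed:
  assumes C: "acute C" "geodesically_convex C"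
    and T: "\<And>i. i \<in> {1..k} \<Longrightarrow> nonexpansive_on C (T i)" and \<alpha>: "\<And>i. i \<in> {1..k} \<Longrightarrow> \<alpha> i \<in> {0..1}"
    and x: "x \<in> C" and p: "p \<in> C" "\<And>i. i \<in> {1..k} \<Longrightarrow> p \<in> fixed_points C (T i)"
  shows "p \<bullet> x \<le> p \<bullet> W_map T \<alpha> k x"
  using T \<alpha> p(2)
proof (induction k)
  case (Suc k)
  define u where "u = W_map T \<alpha> k x"
  have u: "u \<in> C"
    unfolding u_def using Suc.prems by (intro W_map_mem C x) (auto simp: nonexpansive_on_def)
  have T': "nonexpansive_on C (T (Suc k))" and \<alpha>': "\<alpha> (Suc k) \<in> {0..1}"
    and p': "p \<in> fixed_points C (T (Suc k))"
    using Suc.prems by auto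
  have Tu: "T (Suc k) u \<in> C" using T' u by (auto simp: nonexpansive_on_def)
  have "p \<bullet> x \<le> p \<bullet> u" unfolding u_def using Suc by auto
  also have "\<dots> \<le> p \<bullet> T (Suc k) u" by (rule nonexpansive_on_inner_fixed[OF C(1) T' p' u])
  finally have "p \<bullet> x \<le> p \<bullet> geodesic_comb (\<alpha> (Suc k)) (T (Suc k) u) x"
    using inner_geodesic_comb_ge(2)[of "T (Suc k) u" x "\<alpha> (Suc k)" "p \<bullet> x" p]
      acuteD[OF C(1)] Tu x p(1) \<alpha>' by (auto simp: less_imp_le)
  then show ?case by (simp add: u_def)
qed simp

text \<open>If \<open>u n\<close> is no farther from \<open>p\<close> than \<open>x n\<close> and stayed away from \<open>x n\<close>, uniform convexity would put the
  combination strictly closer to \<open>p\<close> than \<open>x n\<close>, by a margin that is uniform because the weights stay away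
  from \<open>0\<close> and \<open>1\<close>.\<close>

lemma geodesic_comb_inner_tendsto_imp:
  fixes p :: "'a::real_inner"
  assumes C: "acute C" and u: "\<And>n. u n \<in> C" and x: "\<And>n. x n \<in> C" and p: "p \<in> C" "l \<in> C"
    and x_lim: "x \<longlonglongrightarrow> l" and le: "\<And>n. p \<bullet> x n \<le> p \<bullet> u n"
    and a: "0 < a" and \<alpha>: "\<And>n. \<alpha> n \<in> {a..1 - a}"
    and z_lim: "(\<lambda>n. p \<bullet> geodesic_comb (\<alpha> n) (u n) (x n)) \<longlonglongrightarrow> p \<bullet> l"
  shows "u \<longlonglongrightarrow> l"
proof -
  define z where "z n = geodesic_comb (\<alpha> n) (u n) (x n)" for n
  have px: "0 < p \<bullet> x n" for n using acuteD(2)[OF C p(1) x] .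
  have pl: "0 < p \<bullet> l" using acuteD(2)[OF C p] .
  have ub: "(norm (u n - x n))\<^sup>2 \<le> ((p \<bullet> z n)\<^sup>2 / (p \<bullet> x n)\<^sup>2 - 1) / a\<^sup>2" for n
  proof -
    have al: "0 \<le> \<alpha> n" "\<alpha> n \<le> 1" "a \<le> \<alpha> n" "a \<le> 1 - \<alpha> n" using \<alpha>[of n] a by auto
    have "a\<^sup>2 \<le> \<alpha> n * (1 - \<alpha> n)"
      unfolding power2_eq_square using al a by (intro mult_mono) auto
    then have "(p \<bullet> x n)\<^sup>2 * (1 + a\<^sup>2 * (norm (u n - x n))\<^sup>2)
        \<le> (p \<bullet> x n)\<^sup>2 * (1 + \<alpha> n * (1 - \<alpha> n) * (norm (u n - x n))\<^sup>2)"
      by (intro mult_left_mono add_mono mult_right_mono) auto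
    also have "\<dots> \<le> (p \<bullet> z n)\<^sup>2"
      unfolding z_def using acuteD(1,3)[OF C] u x al px le
      by (intro inner_geodesic_comb_ge(1)) (auto simp: less_imp_le)
    finally have "1 + a\<^sup>2 * (norm (u n - x n))\<^sup>2 \<le> (p \<bullet> z n)\<^sup>2 / (p \<bullet> x n)\<^sup>2"
      using px[of n] by (simp add: pos_le_divide_eq mult.commute)
    then show ?thesis using a by (simp add: pos_le_divide_eq mult.commute)
  qed
  have "(\<lambda>n. ((p \<bullet> z n)\<^sup>2 / (p \<bullet> x n)\<^sup>2 - 1) / a\<^sup>2) \<longlonglongrightarrow> ((p \<bullet> l)\<^sup>2 / (p \<bullet> l)\<^sup>2 - 1) / a\<^sup>2"
    using a pl by (intro tendsto_intros z_lim[folded z_def] x_lim) auto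
  then have "(\<lambda>n. ((p \<bullet> z n)\<^sup>2 / (p \<bullet> x n)\<^sup>2 - 1) / a\<^sup>2) \<longlonglongrightarrow> 0" using pl by simp
  then have "(\<lambda>n. (norm (u n - x n))\<^sup>2) \<longlonglongrightarrow> 0"
    by (rule tendsto_sandwich[OF _ _ tendsto_const, rotated 2]) (use ub in auto)
  then have "(\<lambda>n. sqrt ((norm (u n - x n))\<^sup>2)) \<longlonglongrightarrow> sqrt 0" by (rule tendsto_real_sqrt)
  then have "(\<lambda>n. u n - x n) \<longlonglongrightarrow> 0" by (simp add: tendsto_norm_zero_iff)
  from tendsto_add[OF this x_lim] show ?thesis by simp
qed

text \<open>This passes from the asymptotic regularity of the W-mappings to the single mappings \<open>T i\<close>, using the
  point \<open>p\<close> only as a reference for measuring the gain of each stage. The stages are squeezed from the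
  outermost inwards: \<open>p \<bullet> x n \<le> p \<bullet> U k n \<le> p \<bullet> T (Suc k) (U k n)\<close>, and both bounds tend to \<open>p \<bullet> l\<close> as soon
  as \<open>p \<bullet> U (Suc k) n\<close> does.\<close>

lemma W_map_limit_fixed:
  fixes C :: "'a::real_inner set"
  assumes C: "acute C" "geodesically_convex C"
    and T: "\<And>i. i \<in> {1..r} \<Longrightarrow> nonexpansive_on C (T i)"
    and a: "0 < a" and \<alpha>: "\<And>n i. i \<in> {1..r} \<Longrightarrow> \<alpha> n i \<in> {a..1 - a}"
    and p: "p \<in> C" "\<And>i. i \<in> {1..r} \<Longrightarrow> p \<in> fixed_points C (T i)"
    and x: "\<And>n. x n \<in> C" and l: "l \<in> C" and x_lim: "x \<longlonglongrightarrow> l"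
    and W_lim: "(\<lambda>n. W_map T (\<alpha> n) r (x n)) \<longlonglongrightarrow> l"
    and i: "i \<in> {1..r}"
  shows "l \<in> fixed_points C (T i)"
proof -
  define U where "U k n = W_map T (\<alpha> n) k (x n)" for k n
  have \<alpha>01: "\<alpha> n j \<in> {0..1}" if "j \<in> {1..r}" for n j
    using \<alpha>[OF that, of n] a by auto
  have UC: "U k n \<in> C" if "k \<le> r" for k n
    unfolding U_def using that T \<alpha>01 by (intro W_map_mem C x) (auto simp: nonexpansive_on_def)
  have pU: "p \<bullet> x n \<le> p \<bullet> U k n" if "k \<le> r" for k n
    unfolding U_def using that T \<alpha>01 p by (intro W_map_inner_fixed[OF C] x) auto
  have TC: "T (Suc k) (U k n) \<in> C" and pT: "p \<bullet> U k n \<le> p \<bullet> T (Suc k) (U k n)" if "k < r" for k n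
  proof -
    have k: "Suc k \<in> {1..r}" and u: "U k n \<in> C" using that UC by auto
    show "T (Suc k) (U k n) \<in> C"
      using T[OF k] u by (auto simp: nonexpansive_on_def)
    show "p \<bullet> U k n \<le> p \<bullet> T (Suc k) (U k n)"
      by (rule nonexpansive_on_inner_fixed[OF C(1) T[OF k] p(2)[OF k] u])
  qed
  have T_lim: "(\<lambda>n. T (Suc k) (U k n)) \<longlonglongrightarrow> l" if k: "k < r" and lim: "(\<lambda>n. p \<bullet> U (Suc k) n) \<longlonglongrightarrow> p \<bullet> l" for k
  proof (rule geodesic_comb_inner_tendsto_imp[OF C(1) TC[OF k] x p(1) l x_lim _ a])
    show "p \<bullet> x n \<le> p \<bullet> T (Suc k) (U k n)" for n
      using pU[of k n] pT[OF k] k by (meson less_imp_le order_trans)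
    show "\<alpha> n (Suc k) \<in> {a..1 - a}" for n using \<alpha> k by simp
    show "(\<lambda>n. p \<bullet> geodesic_comb (\<alpha> n (Suc k)) (T (Suc k) (U k n)) (x n)) \<longlonglongrightarrow> p \<bullet> l"
      using lim by (simp add: U_def)
  qed
  have px_lim: "(\<lambda>n. p \<bullet> x n) \<longlonglongrightarrow> p \<bullet> l" by (intro tendsto_intros x_lim)
  have inner_lim: "(\<lambda>n. p \<bullet> U k n) \<longlonglongrightarrow> p \<bullet> l" if "k \<le> r" for k
    using that
  proof (induction rule: inc_induct)
    case base
    show ?case unfolding U_def by (intro tendsto_intros W_lim)
  next
    case (step k)
    have "(\<lambda>n. p \<bullet> T (Suc k) (U k n)) \<longlonglongrightarrow> p \<bullet> l"
      using T_lim[OF step(2,3)] by (intro tendsto_intros)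
    with px_lim show ?case
      by (rule tendsto_sandwich[rotated 2]) (use pU pT step(2) in auto)
  qed
  have U_lim: "U k \<longlonglongrightarrow> l" if "k < r" for k
  proof (cases k)
    case 0
    then have "U k = x" by (intro ext) (simp add: U_def)
    then show ?thesis using x_lim by simp
  next
    case (Suc j)
    have "norm (U k n - x n) \<le> norm (T k (U j n) - x n)" for n
    proof -
      have nT: "norm (T k (U j n)) = 1" and nx: "norm (x n) = 1" and nU: "norm (U k n) = 1"
        and d: "sdist (T k (U j n)) (x n) < pi"
        using TC[of j n] UC[of k n] x Suc that acuteD[OF C(1)] by auto
      have al: "0 \<le> \<alpha> n k" "\<alpha> n k \<le> 1" using \<alpha>01[of k n] that Suc by auto
      have "sdist (x n) (U k n) = \<alpha> n k * sdist (T k (U j n)) (x n)"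
        using geodesic_comb_in_segment(2)[OF nT nx d al] by (simp add: U_def Suc)
      also have "\<dots> \<le> sdist (T k (U j n)) (x n)"
        using al sdist_bounds(1)[OF nT nx] by (simp add: mult_left_le_one_le)
      finally show ?thesis
        using nT nx nU by (simp add: norm_diff_le_iff_sdist hsphere.commute)
    qed
    moreover have "(\<lambda>n. T k (U j n) - x n) \<longlonglongrightarrow> l - l"
      unfolding Suc using that Suc by (intro tendsto_diff T_lim x_lim inner_lim) auto
    ultimately have "(\<lambda>n. U k n - x n) \<longlonglongrightarrow> 0"
      using tendsto_norm_dominated[of "\<lambda>n. U k n - x n" 0 "\<lambda>n. T k (U j n) - x n" 0 sequentially]
      by simp
    from tendsto_add[OF this x_lim] show ?thesis by simp
  qed
  obtain k where k: "i = Suc k" "k < r" using i by (cases i) auto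
  have Ti: "nonexpansive_on C (T i)" using T i .
  have "T i l \<in> C" using Ti l by (auto simp: nonexpansive_on_def)
  have "norm (T i (U k n) - T i l) \<le> norm (U k n - l)" for n
  proof -
    have "U k n \<in> C" using UC k by simp
    then have "T i (U k n) \<in> C" "sdist (T i (U k n)) (T i l) \<le> sdist (U k n) l"
      using Ti l by (auto simp: nonexpansive_on_def)
    then show ?thesis
      using \<open>U k n \<in> C\<close> \<open>T i l \<in> C\<close> l acuteD(1)[OF C(1)] by (simp add: norm_diff_le_iff_sdist)
  qed
  then have "(\<lambda>n. T i (U k n)) \<longlonglongrightarrow> T i l"
    using U_lim[OF k(2)] by (rule tendsto_norm_dominated)
  moreover have "(\<lambda>n. T i (U k n)) \<longlonglongrightarrow> l"
    unfolding k(1) using k(2) by (intro T_lim inner_lim) auto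
  ultimately have "T i l = l" by (rule LIMSEQ_unique)
  then show ?thesis using l by (simp add: fixed_points_def)
qed

section \<open>The shrinking projection method\<close>


theorem theorem1p2:
  fixes C :: "'a::{real_inner, complete_space} set"
    and T :: "nat \<Rightarrow> 'a \<Rightarrow> 'a"
    and \<alpha> :: "nat \<Rightarrow> nat \<Rightarrow> real"
    and a :: real and r :: nat and x1 :: 'a
    and F :: "'a set" and W :: "nat \<Rightarrow> 'a \<Rightarrow> 'a"
    and Cs :: "nat \<Rightarrow> 'a set" and x :: "nat \<Rightarrow> 'a"
  assumes C_sphere: "C \<subseteq> sphere 0 1"
    and C_closed: "closedin hsphere.mtopology C"
    and C_diam: "\<And>v v'. v \<in> C \<Longrightarrow> v' \<in> C \<Longrightarrow> sdist v v' < pi / 2"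
    and C_convex: "geodesically_convex C"
    and r: "1 \<le> r"
    and a: "0 < a" "a < 1 / 2"
    and \<alpha>: "\<And>n i. 1 \<le> n \<Longrightarrow> i \<in> {1..r} \<Longrightarrow> \<alpha> n i \<in> {a..1 - a}"
    and T: "\<And>i. i \<in> {1..r} \<Longrightarrow> nonexpansive_on C (T i)"
    and F_def: "F = (\<Inter>i\<in>{1..r}. fixed_points C (T i))"
    and F_nonempty: "F \<noteq> {}"
    and W_def: "\<And>n. 1 \<le> n \<Longrightarrow> W n = W_map T (\<alpha> n) r"
    and x1: "x1 \<in> C"
    and Cs_def: "Cs = shrink_set W C x1"
    and x_def: "x = shrink_seq W C x1"
  shows "(\<forall>n. Cs n \<noteq> {} \<and> Cs n \<subseteq> C \<and> closedin hsphere.mtopology (Cs n) \<and>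
              geodesically_convex (Cs n) \<and> (\<exists>!p. is_metric_proj (Cs n) x1 p))
       \<and> (\<forall>n\<ge>1. x n \<in> C)
       \<and> (\<exists>!p. is_metric_proj F x1 p)
       \<and> limitin hsphere.mtopology x (metric_proj F x1) sequentially"
proof -
  have C: "acute C" using C_sphere C_diam by (auto simp: acute_def)
  have nC: "norm v = 1" if "v \<in> C" for v using acuteD(1)[OF C that] .
  have pos: "0 < x1 \<bullet> v" if "v \<in> C" for v using acuteD(2)[OF C x1 that] .
  have \<alpha>01: "\<alpha> n i \<in> {0..1}" if "1 \<le> n" "i \<in> {1..r}" for n i
    using \<alpha>[OF that] a by auto
  have FC: "F \<subseteq> C" using r by (auto simp: F_def fixed_points_def)
  have W_mem: "W n v \<in> C" if "1 \<le> n" "v \<in> C" for n v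
    unfolding W_def[OF that(1)] using that T \<alpha>01
    by (intro W_map_mem[OF C C_convex]) (auto simp: nonexpansive_on_def)
  have W_inner: "p \<bullet> v \<le> p \<bullet> W n v" if "1 \<le> n" "v \<in> C" "p \<in> F" for n v p
    unfolding W_def[OF that(1)] using that T \<alpha>01 FC
    by (intro W_map_inner_fixed[OF C C_convex]) (auto simp: F_def)
  have Cs0: "Cs 0 = C"
    and Cs_Suc: "Cs (Suc n) = {z \<in> C. sdist (W (Suc n) (x (Suc n))) z \<le> sdist (x (Suc n)) z} \<inter> Cs n" for n
    by (simp_all add: Cs_def x_def Let_def)
  have x_1: "x 1 = x1" and x_SucSuc: "x (Suc (Suc n)) = metric_proj (Cs (Suc n)) x1" for n
    by (simp_all add: Cs_def x_def)

  have proj_ex1: "\<exists>!p. is_metric_proj K x1 p"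
    if "K \<subseteq> C" "closed K" "geodesically_convex K" "K \<noteq> {}" for K
    using that acute_subset[OF C] nC x1 pos by (intro metric_proj_ex1) auto
  have inv: "F \<subseteq> Cs n \<and> Cs n \<subseteq> C \<and> closed (Cs n) \<and> geodesically_convex (Cs n) \<and>
      is_metric_proj (Cs n) x1 (x (Suc n))" for n
  proof (induction n)
    case 0
    have "x1 \<bullet> w \<le> x1 \<bullet> x1" if "w \<in> C" for w
      using inner_bounds_sphere(2)[of x1 w] nC that x1 by (simp add: norm_eq_1)
    then have "is_metric_proj C x1 x1"
      using C_sphere nC x1 by (simp add: is_metric_proj_iff_inner)
    then show ?case
      using FC C_convex C_closed closedin_sphere_iff[OF C_sphere] x_1 by (simp add: Cs0)
  next
    case (Suc n)
    let ?x = "x (Suc n)" and ?y = "W (Suc n) (x (Suc n))"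
    have xC: "?x \<in> C" using Suc by (auto simp: is_metric_proj_def)
    then have yC: "?y \<in> C" using W_mem by simp
    have Cs_half: "Cs (Suc n) = (C \<inter> {z. (?x - ?y) \<bullet> z \<le> 0}) \<inter> Cs n"
      unfolding Cs_Suc using closer_set_eq_halfspace[OF C] nC xC yC by simp
    have "p \<in> Cs (Suc n)" if "p \<in> F" for p
    proof -
      have "p \<bullet> ?x \<le> p \<bullet> ?y" using that W_inner xC by simp
      then have "?x \<bullet> p \<le> ?y \<bullet> p" by (simp add: inner_commute)
      then have "(?x - ?y) \<bullet> p \<le> 0" by (simp add: inner_diff_left)
      moreover have "p \<in> C" "p \<in> Cs n" using that FC Suc by blast+
      ultimately show ?thesis unfolding Cs_half by blast
    qed
    then have F: "F \<subseteq> Cs (Suc n)" by blast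
    have sub: "Cs (Suc n) \<subseteq> C" unfolding Cs_half by blast
    have "closed (Cs (Suc n))"
      unfolding Cs_half using Suc C_closed closedin_sphere_iff[OF C_sphere]
      by (intro closed_Int closed_halfspace_le) auto
    moreover have "geodesically_convex (Cs (Suc n))"
      unfolding Cs_half using Suc
      by (intro geodesically_convex_Int geodesically_convex_Int_halfspace C C_convex) auto
    moreover from F F_nonempty have "Cs (Suc n) \<noteq> {}" by blast
    ultimately have "\<exists>!p. is_metric_proj (Cs (Suc n)) x1 p" using sub by (intro proj_ex1) auto
    from theI'[OF this] have "is_metric_proj (Cs (Suc n)) x1 (x (Suc (Suc n)))"
      unfolding x_SucSuc metric_proj_def .
    then show ?case
      using F sub \<open>closed (Cs (Suc n))\<close> \<open>geodesically_convex (Cs (Suc n))\<close> by blast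
  qed
  then have F_sub: "F \<subseteq> Cs n" and Cs_sub: "Cs n \<subseteq> C" and Cs_closed: "closed (Cs n)"
    and Cs_conv: "geodesically_convex (Cs n)" and x_proj: "is_metric_proj (Cs n) x1 (x (Suc n))" for n
    by blast+
  have Cs_ne: "Cs n \<noteq> {}" for n using F_sub F_nonempty by blast
  have Cs_sphere: "Cs n \<subseteq> sphere 0 1" for n using Cs_sub C_sphere by blast
  have x_mem: "x (Suc n) \<in> Cs n" and x_max: "\<And>w. w \<in> Cs n \<Longrightarrow> x1 \<bullet> w \<le> x1 \<bullet> x (Suc n)" for n
    using x_proj[of n] nC x1 Cs_sphere by (auto simp: is_metric_proj_iff_inner)
  have xC: "x (Suc n) \<in> C" for n using x_mem Cs_sub by blast
  have Cs_dec: "decseq Cs" unfolding decseq_Suc_iff by (simp add: Cs_Suc)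

  \<comment> \<open>A common fixed point keeps the decreasing maxima \<open>x1 \<bullet> x (Suc n)\<close> away from \<open>0\<close>.\<close>
  obtain p where p: "p \<in> F" using F_nonempty by blast
  have "decseq (\<lambda>n. x1 \<bullet> x (Suc n))"
    unfolding decseq_Suc_iff
  proof
    fix n show "x1 \<bullet> x (Suc (Suc n)) \<le> x1 \<bullet> x (Suc n)"
      using x_mem[of "Suc n"] Cs_Suc by (intro x_max) auto
  qed
  then obtain L where L: "(\<lambda>n. x1 \<bullet> x (Suc n)) \<longlonglongrightarrow> L" "\<And>n. L \<le> x1 \<bullet> x (Suc n)"
    using decseq_convergent[of "\<lambda>n. x1 \<bullet> x (Suc n)" 0] pos xC by (metis less_imp_le)
  have "x1 \<bullet> p \<le> L"
    using L(1) by (rule LIMSEQ_le_const) (use x_max F_sub p in blast)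
  then have "0 < L" using pos p FC by fastforce
  have "Cauchy (\<lambda>n. x (Suc n))"
    by (rule near_maximizers_Cauchy[OF C Cs_sub Cs_conv Cs_dec x_mem x_max L(1) L(1) \<open>0 < L\<close>])
  then obtain l where l: "(\<lambda>n. x (Suc n)) \<longlonglongrightarrow> l" using Cauchy_convergent convergent_def by blast
  have lCs: "l \<in> Cs n" for n
  proof (rule closed_sequentially[OF Cs_closed])
    show "x (Suc (m + n)) \<in> Cs n" for m
      using x_mem[of "m + n"] decseqD[OF Cs_dec, of n "m + n"] by auto
    show "(\<lambda>m. x (Suc (m + n))) \<longlonglongrightarrow> l" using LIMSEQ_ignore_initial_segment[OF l] .
  qed
  have lC: "l \<in> C" using lCs Cs_sub by blast

  have y_lim: "(\<lambda>n. W (Suc n) (x (Suc n))) \<longlonglongrightarrow> l"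
  proof -
    have "norm (W (Suc n) (x (Suc n)) - l) \<le> norm (x (Suc n) - l)" for n
      using lCs[of "Suc n"] nC lC xC W_mem by (simp add: Cs_Suc norm_diff_le_iff_sdist)
    then show ?thesis using l by (rule tendsto_norm_dominated)
  qed
  have "l \<in> fixed_points C (T i)" if "i \<in> {1..r}" for i
  proof (rule W_map_limit_fixed[OF C C_convex T a(1) _ _ _ xC lC l _ that])
    show "\<alpha> (Suc n) j \<in> {a..1 - a}" if "j \<in> {1..r}" for n j using \<alpha> that by simp
    show "p \<in> C" using p FC by blast
    show "p \<in> fixed_points C (T j)" if "j \<in> {1..r}" for j using p that by (simp add: F_def)
    show "(\<lambda>n. W_map T (\<alpha> (Suc n)) r (x (Suc n))) \<longlonglongrightarrow> l" using y_lim by (simp add: W_def)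
  qed
  then have lF: "l \<in> F" by (simp add: F_def)

  \<comment> \<open>Uniqueness of the projection onto \<open>F\<close> is inherited from the larger convex set \<open>D\<close>.\<close>
  define D where "D = (\<Inter>n. Cs n)"
  have DC: "D \<subseteq> C" using Cs_sub by (auto simp: D_def)
  have D_conv: "geodesically_convex D" unfolding D_def using Cs_conv by (intro geodesically_convex_INT)
  have l_max: "x1 \<bullet> w \<le> x1 \<bullet> l" if "w \<in> D" for w
  proof (rule LIMSEQ_le_const)
    show "(\<lambda>n. x1 \<bullet> x (Suc n)) \<longlonglongrightarrow> x1 \<bullet> l" by (intro tendsto_intros l)
    show "\<exists>N. \<forall>n\<ge>N. x1 \<bullet> w \<le> x1 \<bullet> x (Suc n)" using that x_max by (auto simp: D_def)
  qed
  have FD: "F \<subseteq> D" using F_sub by (auto simp: D_def)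
  have DS: "D \<subseteq> sphere 0 1" and FS: "F \<subseteq> sphere 0 1" using DC FC C_sphere by blast+
  have proj_D: "is_metric_proj D x1 l"
    using l_max FD lF nC x1 by (auto simp: is_metric_proj_iff_inner[OF DS])
  have proj_F: "is_metric_proj F x1 l"
    using l_max FD lF nC x1 by (auto simp: is_metric_proj_iff_inner[OF FS])
  have uniq: "q = l" if "is_metric_proj F x1 q" for q
  proof -
    have q: "q \<in> F" "x1 \<bullet> l \<le> x1 \<bullet> q"
      using that lF nC x1 by (auto simp: is_metric_proj_iff_inner[OF FS])
    then have "is_metric_proj D x1 q"
      using l_max FD nC x1 by (auto simp: is_metric_proj_iff_inner[OF DS] intro: order_trans)
    then show ?thesis
      using metric_proj_unique[OF acute_subset[OF C DC] D_conv nC[OF x1] _ _ proj_D] pos DC by blast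
  qed
  have F_ex1: "\<exists>!q. is_metric_proj F x1 q" using proj_F uniq by blast
  have "metric_proj F x1 = l" unfolding metric_proj_def using proj_F uniq by (rule the_equality)
  moreover have xC_all: "x n \<in> C" for n
  proof (cases n)
    \<comment> \<open>The sequence starts at index 1; its dummy value at 0 is \<open>x1\<close>.\<close>
    case 0
    then show ?thesis using x1 by (simp add: x_def)
  qed (simp add: xC)
  moreover have "x \<longlonglongrightarrow> l" using l by (rule LIMSEQ_imp_Suc)
  ultimately have lim: "limitin hsphere.mtopology x (metric_proj F x1) sequentially"
    using limitin_sphere_iff[of x l] nC lC by simp
  have Cs_props: "Cs n \<noteq> {} \<and> Cs n \<subseteq> C \<and> closedin hsphere.mtopology (Cs n) \<and>
      geodesically_convex (Cs n) \<and> (\<exists>!p. is_metric_proj (Cs n) x1 p)" for n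
    by (intro conjI Cs_ne Cs_sub Cs_conv proj_ex1 Cs_closed)
       (simp add: closedin_sphere_iff[OF Cs_sphere] Cs_closed)
  show ?thesis
    by (intro conjI allI impI Cs_props xC_all F_ex1 lim)
qed

end
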